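(* Let $\mathcal{K}\subseteq\mathbb{C}_h^{n\times n}$ be a coherent set of strictly desirable gambles (SDG), and let $\mathcal{K}^{\mathrm{dual}}=\{R\in\mathbb{C}_h^{n\times n}\mid G\cdot R\ge 0\ \forall G\in\mathcal{K}\}$. Then the set of those members of $\mathcal{K}^{\mathrm{dual}}$ that preserve constants is $$\mathcal{M}=\{\rho\in\mathcal{D}_h^{n\times n}\mid G\cdot\rho\ge 0\ \forall G\in\mathcal{K}\},$$ where $\mathcal{D}_h^{n\times n}=\{R\in\mathbb{C}_h^{n\times n}\mid R\ge 0,\ \mathrm{Tr}(R)=1\}$ is the set of density matrices.
   Context: $\mathbb{C}_h^{n\times n}$ is the real vector space of $n\times n$ complex Hermitian matrices, with inner product $G\cdot R=\mathrm{Tr}(G^\dagger R)$. For $G\in\mathbb{C}_h^{n\times n}$: $G\geq 0$ means positive semi-definite; $G\gneq 0$ means $G\ge 0$ and $G\ne 0$; $G>0$ means positive definite. A set $\mathcal{K}\subseteq\mathbb{C}_h^{n\times n}$ is a coherent set of strictly desirable gambles (SDG) if: (S1) $\mathcal{K}$ is a non-pointed convex cone, i.e. closed under addition and under multiplication by reals $\nu>0$, and $0\notin\mathcal{K}$; (S2) every $G\gneq 0$ belongs to $\mathcal{K}$; (S3) if $G\in\mathcal{K}$ then either $G\gneq 0$ or $G-\Delta\in\mathcal{K}$ for some $\Delta\in\mathbb{C}_h^{n\times n}$ with $\Delta>0$. A matrix $R\in\mathbb{C}_h^{n\times n}$ preserves constants if $(cI)\cdot R=c$ for every $c\in\mathbb{R}$,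 where $I$ is the identity matrix. *)

theory Defs
  imports "HOL-Analysis.Analysis"
begin

definition conj_transpose :: "complex^'n^'m \<Rightarrow> complex^'m^'n" where
  "conj_transpose A = (\<chi> i j. cnj (A $ j $ i))"

definition hermitian :: "complex^'n^'n \<Rightarrow> bool" where
  "hermitian A \<longleftrightarrow> conj_transpose A = A"

text \<open>The quadratic form is \<open>x\<^sup>\<dagger> A x\<close>.\<close>

definition quad_form :: "complex^'n^'n \<Rightarrow> complex^'n \<Rightarrow> complex" where
  "quad_form A x = (\<Sum>i\<in>UNIV. cnj (x $ i) * (A *v x) $ i)"

text \<open>Taking real parts loses nothing on Hermitian matrices: the quadratic form and the trace
  product below are real there (lemmas \<open>quad_form_real\<close> and \<open>trace_prod_real\<close>).\<close>

definition pos_semidef :: "complex^'n^'n \<Rightarrow> bool" where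
  "pos_semidef A \<longleftrightarrow> hermitian A \<and> (\<forall>x. 0 \<le> Re (quad_form A x))"

definition pos_def :: "complex^'n^'n \<Rightarrow> bool" where
  "pos_def A \<longleftrightarrow> hermitian A \<and> (\<forall>x. x \<noteq> 0 \<longrightarrow> 0 < Re (quad_form A x))"

definition pos_semidef_nonzero :: "complex^'n^'n \<Rightarrow> bool" where
  "pos_semidef_nonzero A \<longleftrightarrow> pos_semidef A \<and> A \<noteq> 0"

definition trace_prod :: "complex^'n^'n \<Rightarrow> complex^'n^'n \<Rightarrow> real" where
  "trace_prod G R = Re (trace (conj_transpose G ** R))"

lemma hermitian_nth: "hermitian A \<Longrightarrow> cnj (A $ j $ i) = A $ i $ j"
  by (simp add: hermitian_def conj_transpose_def vec_eq_iff)

lemma quad_form_real: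
  assumes "hermitian A"
  shows "quad_form A x \<in> \<real>"
proof -
  have "cnj (quad_form A x)
      = (\<Sum>i\<in>UNIV. \<Sum>j\<in>UNIV. cnj (x $ j) * A $ j $ i * x $ i)"
    by (simp add: quad_form_def matrix_vector_mult_def sum_distrib_left
        hermitian_nth[OF assms] mult_ac)
  also have "\<dots> = quad_form A x"
    by (subst sum.swap)
       (simp add: quad_form_def matrix_vector_mult_def sum_distrib_left mult_ac)
  finally show ?thesis
    by (simp add: Reals_cnj_iff)
qed

lemma trace_prod_real:
  assumes "hermitian G" "hermitian R"
  shows "trace (conj_transpose G ** R) \<in> \<real>"
proof -
  have GR: "conj_transpose G ** R = G ** R"
    using assms(1) by (simp add: hermitian_def)
  have "cnj (trace (G ** R)) = trace (R ** G)"
    by (simp add: trace_def matrix_matrix_mult_def hermitian_nth[OF assms(1)]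
        hermitian_nth[OF assms(2)] mult_ac)
  also have "\<dots> = trace (G ** R)"
    by (rule trace_mul_sym)
  finally show ?thesis
    by (simp add: GR Reals_cnj_iff)
qed

text \<open>The trace product is the library's Euclidean inner product on \<open>complex^'n^'n\<close>.\<close>

lemma trace_prod_eq_inner: "trace_prod G R = G \<bullet> R"
  unfolding trace_prod_def trace_def matrix_matrix_mult_def conj_transpose_def inner_vec_def
  by (simp add: inner_complex_def, rule sum.swap)

definition coherent_SDG :: "(complex^'n^'n) set \<Rightarrow> bool" where
  "coherent_SDG K \<longleftrightarrow>
     K \<subseteq> {G. hermitian G} \<and>
     (\<forall>G\<in>K. \<forall>H\<in>K. G + H \<in> K) \<and>
     (\<forall>G\<in>K. \<forall>\<nu>::real. \<nu> > 0 \<longrightarrow> \<nu> *\<^sub>R G \<in> K) \<and>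
     0 \<notin> K \<and>
     (\<forall>G. pos_semidef_nonzero G \<longrightarrow> G \<in> K) \<and>
     (\<forall>G\<in>K. pos_semidef_nonzero G \<or> (\<exists>\<Delta>. pos_def \<Delta> \<and> G - \<Delta> \<in> K))"

definition dual_cone :: "(complex^'n^'n) set \<Rightarrow> (complex^'n^'n) set" where
  "dual_cone K = {R. hermitian R \<and> (\<forall>G\<in>K. 0 \<le> trace_prod G R)}"

definition preserves_constants :: "complex^'n^'n \<Rightarrow> bool" where
  "preserves_constants R \<longleftrightarrow> (\<forall>c::real. trace_prod (c *\<^sub>R mat 1) R = c)"

definition density_matrices :: "(complex^'n^'n) set" where
  "density_matrices = {R. pos_semidef R \<and> trace R = 1}"

end

(* Testing R in the dual cone against the rank-one gambles x x^dagger, which are positive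
   semi-definite and hence belong to K, yields x^dagger R x \<ge> 0. *)
theory Submission
  imports Defs
begin

text \<open>Both sets demand nonnegativity against \<open>K\<close>, so only two points remain.
  Since \<open>K\<close> contains every nonzero x x^dagger, the dual cone lies inside the positive
  semi-definite cone (\<open>pos_semidef_if_mem_dual_cone\<close>). Since cI . R = c Tr(R),
  preserving constants amounts to unit trace (\<open>preserves_constants_iff\<close>).\<close>

definition rank_one :: "complex^'n \<Rightarrow> complex^'n^'n" where
  "rank_one x = (\<chi> i j. x $ i * cnj (x $ j))"

lemma hermitian_rank_one: "hermitian (rank_one x)"
  by (simp add: hermitian_def conj_transpose_def rank_one_def vec_eq_iff)

text \<open>The form factors as (y^dagger x)(x^dagger y), a number times its conjugate.\<close>

lemma quad_form_rank_one:
  "quad_form (rank_one x) y = of_real ((cmod (\<Sum>i\<in>UNIV. cnj (y $ i) * x $ i))\<^sup>2)"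
  unfolding complex_norm_square
  by (simp add: quad_form_def rank_one_def matrix_vector_mult_def sum_product
      sum_distrib_left mult_ac, rule sum.swap)

lemma pos_semidef_rank_one: "pos_semidef (rank_one x)"
  by (simp add: pos_semidef_def hermitian_rank_one quad_form_rank_one del: of_real_power)

lemma rank_one_eq_0_iff: "rank_one x = 0 \<longleftrightarrow> x = 0"
  by (auto simp: rank_one_def vec_eq_iff)

text \<open>Cyclicity of the trace: Tr(x x^dagger R) = x^dagger R x.\<close>

lemma trace_prod_rank_one: "trace_prod (rank_one x) R = Re (quad_form R x)"
proof -
  have "trace (conj_transpose (rank_one x) ** R)
      = (\<Sum>i\<in>UNIV. \<Sum>k\<in>UNIV. cnj (x $ k) * (R $ k $ i * x $ i))"
    by (simp add: trace_def matrix_matrix_mult_def conj_transpose_def rank_one_def mult_ac)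
  also have "\<dots> = quad_form R x"
    by (subst sum.swap) (simp add: quad_form_def matrix_vector_mult_def sum_distrib_left)
  finally show ?thesis
    by (simp add: trace_prod_def)
qed

lemma pos_semidef_if_mem_dual_cone:
  assumes "\<And>G. pos_semidef_nonzero G \<Longrightarrow> G \<in> K" and "R \<in> dual_cone K"
  shows "pos_semidef R"
proof -
  have "0 \<le> Re (quad_form R x)" for x
  \<comment> \<open>The zero vector gives the zero matrix, which \<open>pos_semidef_nonzero\<close>
    excludes, so it is treated apart.\<close>
  proof (cases "x = 0")
    case True
    then show ?thesis by (simp add: quad_form_def)
  next
    case False
    then have "rank_one x \<in> K"
      using assms(1) by (simp add: pos_semidef_nonzero_def pos_semidef_rank_one rank_one_eq_0_iff)
    then show ?thesis
      using assms(2) by (auto simp: dual_cone_def simp flip: trace_prod_rank_one)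
  qed
  then show ?thesis
    using assms(2) by (simp add: pos_semidef_def dual_cone_def)
qed

lemma conj_transpose_mat_1: "conj_transpose (mat 1) = mat 1"
  by (auto simp: conj_transpose_def mat_def vec_eq_iff)

lemma preserves_constants_iff:
  assumes "hermitian R"
  shows "preserves_constants R \<longleftrightarrow> trace R = 1"
proof -
  have "trace_prod (c *\<^sub>R mat 1) R = c * Re (trace R)" for c
  proof -
    have "trace_prod (c *\<^sub>R mat 1) R = c * trace_prod (mat 1) R"
      by (simp add: trace_prod_eq_inner)
    then show ?thesis
      by (simp add: trace_prod_def conj_transpose_mat_1)
  qed
  then have "preserves_constants R \<longleftrightarrow> Re (trace R) = 1"
    unfolding preserves_constants_def by (metis mult.right_neutral mult_1)
  \<comment> \<open>\<open>trace_prod\<close> sees only the real part of the trace; hermiticity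
    makes the imaginary part vanish.\<close>
  moreover have "trace R \<in> \<real>"
    using trace_prod_real[of "mat 1" R] assms by (simp add: hermitian_def conj_transpose_mat_1)
  ultimately show ?thesis
    by (simp add: complex_eq_iff complex_is_Real_iff)
qed

theorem mainTheorem2:
  fixes K :: "(complex^'n^'n) set"
  assumes "coherent_SDG K"
  shows "{R \<in> dual_cone K. preserves_constants R}
       = {\<rho> \<in> density_matrices. \<forall>G\<in>K. 0 \<le> trace_prod G \<rho>}"
proof -
  have "G \<in> K" if "pos_semidef_nonzero G" for G
    using assms that by (simp add: coherent_SDG_def)
  then have "pos_semidef R" if "R \<in> dual_cone K" for R
    using that by (rule pos_semidef_if_mem_dual_cone)
  then show ?thesis
    \<comment> \<open>Hermiticity, required by \<open>preserves_constants_iff\<close>, is part of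
      membership on either side.\<close>
    by (auto simp: density_matrices_def dual_cone_def pos_semidef_def preserves_constants_iff)
qed

end
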